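(* Let $f : \mathbb{R} \to \mathbb{R}$ be a Borel measurable function satisfying $$f(x) + f(y) = f\left(\frac{x+y}{1-xy}\right) \quad \text{for all } x, y \in \mathbb{R} \text{ with } xy \neq 1.$$ Then $f(x) = 0$ for every $x \in \mathbb{R}$. *)

theory Defs
  imports "HOL-Analysis.Analysis"
begin

end

theory Submission
  imports Defs
begin

text \<open>
  Put \<open>F \<theta> = f (tan \<theta>)\<close>, a measurable function of period \<open>\<pi>\<close> with
  \<open>F (\<theta> + a) = F \<theta> + F a\<close> for almost every \<open>\<theta>\<close>. By translation invariance,
  the bounded functions \<open>arctan (F \<theta>)\<close> and \<open>arctan (F \<theta> + F a)\<close> have the same integral over a
  period; as \<open>arctan\<close> is strictly increasing, \<open>F a > 0\<close> is impossible. Since \<open>f\<close> is odd,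
  \<open>F a < 0\<close> is impossible as well.
\<close>

text \<open>Splitting \<open>{0..p + a}\<close> at \<open>a\<close> and at \<open>p\<close> leaves
  the two integrals in question plus the pieces over \<open>{0..a}\<close> and
  \<open>{p..p + a}\<close>, which agree by periodicity.\<close>

lemma integral_periodic_shift:
  fixes g :: "real \<Rightarrow> 'a::banach"
  assumes per: "\<And>x. g (x + p) = g x" and int: "\<And>u v. g integrable_on {u..v}"
    and "0 \<le> p" "0 \<le> a"
  shows "integral {0..p} (\<lambda>x. g (x + a)) = integral {0..p} g"
proof -
  have shift: "integral {u..v} (\<lambda>x. g (x + c)) = integral {u + c..v + c} g" for u v c
    using integral_shift_real_ivl[of "u + c" c "v + c" g] by simp
  have "integral {0..a} g + integral {a..p + a} g = integral {0..p + a} g"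
    using assms by (intro Henstock_Kurzweil_Integration.integral_combine) auto
  moreover have "integral {0..p} g + integral {p..p + a} g = integral {0..p + a} g"
    using assms by (intro Henstock_Kurzweil_Integration.integral_combine) auto
  moreover have "integral {p..p + a} g = integral {0..a} g"
    using shift[of 0 a p] by (simp add: per add.commute)
  ultimately show ?thesis
    using shift[of 0 p a] by (simp add: add.commute) (metis add.commute add_left_imp_eq)
qed

lemma bounded_set_integrable_lborel:
  fixes g :: "real \<Rightarrow> real"
  assumes [measurable]: "g \<in> borel_measurable borel" and "\<And>x. \<bar>g x\<bar> \<le> B"
  shows "set_integrable lborel {u..v} g"
proof (rule set_integrable_bound)
  show "set_integrable lborel {u..v} (\<lambda>_. B)"
    by (rule borel_integrable_atLeastAtMost') simp
  show "set_borel_measurable lborel {u..v} g"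
    unfolding set_borel_measurable_def by measurable
  show "AE x in lborel. x \<in> {u..v} \<longrightarrow> norm (g x) \<le> norm B"
    using assms(2) by (auto intro: order.trans[OF _ abs_ge_self])
qed

text \<open>The zeros form a countable, hence null, set; away from them the addition formula for
  \<open>tan\<close> applies.\<close>

lemma AE_lborel_cos_neq_0: "AE x in lborel. cos (x + a :: real) \<noteq> 0"
proof -
  have "{x. cos (x + a) = 0} = range (\<lambda>n::int. n * pi + pi/2 - a)"
    by (force simp: cos_zero_iff_int2 algebra_simps)
  then have "{x. cos (x + a) = 0} \<in> null_sets lborel"
    by (intro countable_imp_null_set_lborel) auto
  from AE_not_in[OF this] show ?thesis by simp
qed

lemma tan_addition_nonpos:
  fixes f :: "real \<Rightarrow> real"
  assumes [measurable]: "f \<in> borel_measurable borel"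
    and add: "\<And>x y. x * y \<noteq> 1 \<Longrightarrow> f x + f y = f ((x + y) / (1 - x * y))"
  shows "f t \<le> 0"
proof (rule ccontr)
  assume "\<not> f t \<le> 0"
  then have pos: "0 < f t" by simp
  \<comment> \<open>Adding the period \<open>pi\<close> keeps \<open>tan a = t\<close> and makes the
    shift nonnegative, as \<open>integral_periodic_shift\<close> requires.\<close>
  define a where "a = arctan t + pi"
  \<comment> \<open>\<open>f\<close> may be unbounded; composing with \<open>arctan\<close> gives
    integrability on intervals and preserves strict inequalities.\<close>
  define g where "g = (\<lambda>x. arctan (f (tan x)))"
  have "0 \<le> a"
    unfolding a_def using arctan_lbound[of t] pi_gt_zero by linarith
  then have a: "tan a = t" "cos a \<noteq> 0" "0 \<le> a"
    by (simp_all add: a_def tan_arctan)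
  have [measurable]: "g \<in> borel_measurable borel"
    unfolding g_def tan_def by measurable
  have bd: "\<bar>g x\<bar> \<le> pi / 2" for x
    using arctan_bounded[of "f (tan x)"] by (auto simp: g_def)
  have int: "set_integrable lborel {u..v} g" for u v
    by (rule bounded_set_integrable_lborel[OF _ bd]) simp
  have int_a: "set_integrable lborel {u..v} (\<lambda>x. g (x + a))" for u v
    by (rule bounded_set_integrable_lborel[OF _ bd]) simp
  let ?D = "\<lambda>x. indicator {0..pi} x *\<^sub>R (g (x + a) - g x)"
  have "integral {0..pi} (\<lambda>x. g (x + a)) = integral {0..pi} g"
    by (rule integral_periodic_shift)
       (use a set_borel_integral_eq_integral(1)[OF int] in \<open>auto simp: g_def\<close>)
  then have "(LINT x:{0..pi}|lborel. g (x + a) - g x) = 0"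
    by (simp add: set_integral_diff int int_a set_borel_integral_eq_integral(2))
  then have int0: "integral\<^sup>L lborel ?D = 0"
    by (simp add: set_lebesgue_integral_def)
  have incr: "AE x in lborel. g x < g (x + a)"
    using AE_lborel_cos_neq_0[of 0] AE_lborel_cos_neq_0[of a]
  proof eventually_elim
    case (elim x)
    \<comment> \<open>\<open>1 - tan x * tan a\<close> equals
      \<open>cos (x + a) / (cos x * cos a)\<close>, which is nonzero here.\<close>
    then have "tan x * t \<noteq> 1"
      using a lemma_tan_add1[of x a] by auto
    then have "f (tan (x + a)) = f (tan x) + f t"
      using elim a by (simp add: tan_add add)
    then show ?case
      using pos by (simp add: g_def arctan_less_iff)
  qed
  have "integrable lborel ?D"
    using set_integral_diff(1)[OF int_a int] by (simp add: set_integrable_def)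
  moreover have "AE x in lborel. 0 \<le> ?D x"
    using incr by eventually_elim (auto simp: indicator_def)
  ultimately have "AE x in lborel. ?D x = 0"
    using int0 integral_nonneg_eq_0_iff_AE by blast
  \<comment> \<open>On \<open>{0..pi}\<close> the difference is almost everywhere both zero and
    strictly positive, so this interval would be null.\<close>
  with incr have "AE x in lborel. x \<notin> {0..pi::real}"
    by eventually_elim (auto simp: indicator_def)
  then have "emeasure lborel {0..pi} = 0"
    by (subst (asm) AE_iff_measurable[where N = "{0..pi}"]) auto
  then show False by simp
qed

theorem corollary4p1:
  fixes f :: "real \<Rightarrow> real"
  assumes "f \<in> borel_measurable borel"
    and "\<And>x y :: real. x * y \<noteq> 1 \<Longrightarrow> f x + f y = f ((x + y) / (1 - x * y))"
  shows "\<forall>x :: real. f x = 0"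
proof
  fix x :: real
  have "f 0 = 0" using assms(2)[of 0 0] by simp
  moreover have "x * - x \<noteq> 1"
    using zero_le_square[of x] by linarith
  ultimately have "f (- x) = - f x"
    using assms(2)[of x "- x"] by simp
  then show "f x = 0"
    using tan_addition_nonpos[OF assms, of x] tan_addition_nonpos[OF assms, of "- x"] by simp
qed

end
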